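(* Let $(X;\leq)$ be a poset. (a) If every order component of $X$ (with the induced order) is representable, then $X$ is representable. (b) If $X$ is representable, then every order component $Y$ of $X$ is compact with respect to its own interval topology $\tau_i(Y)$. (c) There exists a representable poset having an order component which (with the induced order) is not representable.
   Context: A poset is representable if it is order-isomorphic to the poset of prime ideals (ordered by inclusion) of a bounded distributive lattice; equivalently, $(X;\leq)$ is representable iff there is a topology $\tau$ on $X$ such that $(X;\tau,\leq)$ is a Priestley space, i.e. $(X;\tau)$ is compact and whenever $x\not\geq y$ there is a clopen down-set $U$ with $x\in U$, $y\notin U$. For a poset $X$, let $R=\{(x,y): x\le y \text{ or } y\le x\}$ and $R'$ its transitive closure; an order component of $X$ is an equivalence class of $R'$. For $x\in X$, $(x]=\{z: z\le x\}$, $[x)=\{z: z\ge x\}$. The interval topology $\tau_i(X)$ is the topology with subbase $\{X\setminus (x]: x\in X\}\cup\{X\setminus [x): x\in X\}$. *)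

theory Defs
  imports "HOL-Analysis.Analysis"
begin

definition poset :: "'a set \<Rightarrow> ('a \<Rightarrow> 'a \<Rightarrow> bool) \<Rightarrow> bool" where
  "poset X le \<longleftrightarrow>
     (\<forall>x\<in>X. le x x) \<and>
     (\<forall>x\<in>X. \<forall>y\<in>X. le x y \<and> le y x \<longrightarrow> x = y) \<and>
     (\<forall>x\<in>X. \<forall>y\<in>X. \<forall>z\<in>X. le x y \<and> le y z \<longrightarrow> le x z)"

definition is_downset :: "'a set \<Rightarrow> ('a \<Rightarrow> 'a \<Rightarrow> bool) \<Rightarrow> 'a set \<Rightarrow> bool" where
  "is_downset X le U \<longleftrightarrow> U \<subseteq> X \<and> (\<forall>z\<in>U. \<forall>w\<in>X. le w z \<longrightarrow> w \<in> U)"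

definition priestley_space :: "'a set \<Rightarrow> 'a topology \<Rightarrow> ('a \<Rightarrow> 'a \<Rightarrow> bool) \<Rightarrow> bool" where
  "priestley_space X T le \<longleftrightarrow>
     topspace T = X \<and> compact_space T \<and>
     (\<forall>x\<in>X. \<forall>y\<in>X. \<not> le y x \<longrightarrow>
        (\<exists>U. openin T U \<and> closedin T U \<and> is_downset X le U \<and> x \<in> U \<and> y \<notin> U))"

text \<open>Representable poset (via the Priestley-space characterisation).\<close>
definition representable :: "'a set \<Rightarrow> ('a \<Rightarrow> 'a \<Rightarrow> bool) \<Rightarrow> bool" where
  "representable X le \<longleftrightarrow> (\<exists>T. priestley_space X T le)"

definition comparable :: "'a set \<Rightarrow> ('a \<Rightarrow> 'a \<Rightarrow> bool) \<Rightarrow> 'a \<Rightarrow> 'a \<Rightarrow> bool" where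
  "comparable X le x y \<longleftrightarrow> x \<in> X \<and> y \<in> X \<and> (le x y \<or> le y x)"

definition order_components :: "'a set \<Rightarrow> ('a \<Rightarrow> 'a \<Rightarrow> bool) \<Rightarrow> 'a set set" where
  "order_components X le = {{y. (comparable X le)\<^sup>+\<^sup>+ x y} | x. x \<in> X}"

definition down_closure :: "'a set \<Rightarrow> ('a \<Rightarrow> 'a \<Rightarrow> bool) \<Rightarrow> 'a \<Rightarrow> 'a set" where
  "down_closure X le x = {z \<in> X. le z x}"

definition up_closure :: "'a set \<Rightarrow> ('a \<Rightarrow> 'a \<Rightarrow> bool) \<Rightarrow> 'a \<Rightarrow> 'a set" where
  "up_closure X le x = {z \<in> X. le x z}"

text \<open>Interval topology on X: generated by the subbase of complements of principal
  down-sets and up-sets (X itself added so that the underlying space is X even when the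
  subbase is degenerate; this does not change the topology).\<close>
definition interval_topology :: "'a set \<Rightarrow> ('a \<Rightarrow> 'a \<Rightarrow> bool) \<Rightarrow> 'a topology" where
  "interval_topology X le = topology_generated_by
     (insert X ({X - down_closure X le x | x. x \<in> X} \<union> {X - up_closure X le x | x. x \<in> X}))"

end

theory Submission
  imports Defs
begin

text \<open>
  (a) Give \<open>X\<close> the disjoint sum of the topologies of its components, except that the
  neighbourhoods of one chosen point have to contain all but finitely many components.

  (b) In a Priestley space all sets \<open>(x]\<close> and \<open>[x)\<close> are compact, and for \<open>x\<close> in a
  component \<open>Y\<close> they lie inside \<open>Y\<close>; Alexander's subbase theorem does the rest.

  (c) Read a set of naturals as the strictly increasing word of its elements, so that the
  power set of the naturals, with the Cantor topology, consists of finite and infinite words.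
  A finite word \<open>w\<close> is the limit of its one-letter extensions \<open>wm\<close> for growing \<open>m\<close>.  Order
  them as a chain, decreasing to \<open>w\<close> if \<open>w\<close> has even length and increasing to \<open>w\<close> if it has
  odd length.  The order generated in this way makes the Cantor space a Priestley space,
  and the finite words form an order component \<open>Y\<close>.  In any Priestley topology on \<open>Y\<close> the set
  of words of length at most \<open>n\<close> is closed, because it arises from the empty word by taking
  \<open>n\<close> alternating up- and down-closures, and it has empty interior, because \<open>wm\<close> still
  converges to \<open>w\<close>.  As \<open>Y\<close> is the union of these countably many sets, this contradicts Baire's
  theorem.
\<close>

section \<open>Priestley spaces\<close>

lemma poset_dual: "poset X le \<Longrightarrow> poset X (\<lambda>x y. le y x)"
  unfolding poset_def by metis

lemma priestley_space_dual:
  assumes "priestley_space X T le"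
  shows "priestley_space X T (\<lambda>x y. le y x)"
proof -
  have "\<exists>U. openin T U \<and> closedin T U \<and> is_downset X (\<lambda>x y. le y x) U \<and> x \<in> U \<and> y \<notin> U"
    if xy: "x \<in> X" "y \<in> X" "\<not> le x y" for x y
  proof -
    obtain U where U: "openin T U" "closedin T U" "is_downset X le U" "y \<in> U" "x \<notin> U"
      using assms xy unfolding priestley_space_def by blast
    have "is_downset X (\<lambda>x y. le y x) (X - U)"
      using U(3) by (auto simp: is_downset_def)
    moreover have "openin T (X - U)" "closedin T (X - U)"
      using U assms by (auto simp: priestley_space_def)
    ultimately show ?thesis
      using U xy by blast
  qed
  then show ?thesis
    using assms by (auto simp: priestley_space_def)
qed

text \<open>A point y not above \<open>F\<close> is separated from each x in \<open>F\<close> by a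
  clopen down-set that contains y and misses x. By compactness finitely many of the complements
  cover \<open>F\<close>; the intersection of the corresponding down-sets is a neighbourhood of y
  without points above \<open>F\<close>.\<close>

lemma priestley_space_closedin_up:
  assumes P: "priestley_space X T le" and F: "compactin T F"
  shows "closedin T {y \<in> X. \<exists>x\<in>F. le x y}"
proof -
  have top: "topspace T = X"
    using P by (simp add: priestley_space_def)
  have FX: "F \<subseteq> X"
    using F top by (auto simp: compactin_def)
  let ?D = "{y \<in> X. \<exists>x\<in>F. le x y}"
  have "\<exists>W. openin T W \<and> y \<in> W \<and> W \<subseteq> X - ?D" if y: "y \<in> X - ?D" for y
  proof -
    let ?\<U> = "{X - U | U. openin T U \<and> closedin T U \<and> is_downset X le U \<and> y \<in> U}"
    have "F \<subseteq> \<Union>?\<U>"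
    proof
      fix x assume "x \<in> F"
      then have "\<not> le x y" "x \<in> X"
        using y FX by auto
      then obtain U where "openin T U" "closedin T U" "is_downset X le U" "y \<in> U" "x \<notin> U"
        using P y unfolding priestley_space_def by blast
      then show "x \<in> \<Union>?\<U>"
        using \<open>x \<in> X\<close> by blast
    qed
    moreover have "\<forall>V\<in>?\<U>. openin T V"
      using top by auto
    ultimately obtain \<F> where \<F>: "finite \<F>" "\<F> \<subseteq> ?\<U>" "F \<subseteq> \<Union>\<F>"
      using F unfolding compactin_def by meson
    let ?W = "X - \<Union>\<F>"
    have "closedin T V" if "V \<in> \<F>" for V
      using that \<F>(2) top by auto
    then have "closedin T (\<Union>\<F>)"
      using \<F>(1) by (intro closedin_Union) auto
    then have "openin T ?W"
      using top by auto
    moreover have "y \<in> ?W"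
      using \<F>(2) y by auto
    moreover have "?W \<subseteq> X - ?D"
    proof -
      have False if "z \<in> ?W" "x \<in> F" "le x z" for z x
      proof -
        obtain V where V: "V \<in> \<F>" "x \<in> V"
          using \<F>(3) \<open>x \<in> F\<close> by blast
        then obtain U where U: "V = X - U" "is_downset X le U"
          using \<F>(2) by blast
        then have "x \<in> U"
          using that V FX unfolding is_downset_def by blast
        then show False
          using U V by blast
      qed
      then show ?thesis by blast
    qed
    ultimately show ?thesis by blast
  qed
  then have "openin T (X - ?D)"
    by (subst openin_subopen) blast
  then show ?thesis
    using top by (auto simp: closedin_def)
qed

lemma priestley_space_closedin_down:
  assumes "priestley_space X T le" "compactin T F"
  shows "closedin T {y \<in> X. \<exists>x\<in>F. le y x}"
  using priestley_space_closedin_up[OF priestley_space_dual[OF assms(1)] assms(2)] by simp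

lemma priestley_space_closedin_up_closure:
  assumes "priestley_space X T le" "x \<in> X"
  shows "closedin T (up_closure X le x)"
proof -
  have "compactin T {x}"
    using assms by (simp add: priestley_space_def)
  from priestley_space_closedin_up[OF assms(1) this] show ?thesis
    by (simp add: up_closure_def)
qed

lemma priestley_space_closedin_down_closure:
  assumes "priestley_space X T le" "x \<in> X"
  shows "closedin T (down_closure X le x)"
  using priestley_space_closedin_up_closure[OF priestley_space_dual[OF assms(1)] assms(2)]
  by (simp add: up_closure_def down_closure_def)

lemma priestley_space_imp_Hausdorff:
  assumes P: "priestley_space X T le" and "poset X le"
  shows "Hausdorff_space T"
proof -
  have top: "topspace T = X"
    using P by (simp add: priestley_space_def)
  have sep: "\<exists>U V. openin T U \<and> openin T V \<and> x \<in> U \<and> y \<in> V \<and> disjnt U V"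
    if xy: "x \<in> X" "y \<in> X" "\<not> le y x" for x y
  proof -
    obtain U where "openin T U" "closedin T U" "x \<in> U" "y \<notin> U"
      using P xy unfolding priestley_space_def by blast
    then show ?thesis
      using xy top by (intro exI[of _ U] exI[of _ "X - U"]) (auto simp: disjnt_def)
  qed
  show ?thesis
    unfolding Hausdorff_space_def top
  proof (intro allI impI)
    fix x y assume xy: "x \<in> X \<and> y \<in> X \<and> x \<noteq> y"
    then have "\<not> le y x \<or> \<not> le x y"
      using \<open>poset X le\<close> unfolding poset_def by blast
    then show "\<exists>U V. openin T U \<and> openin T V \<and> x \<in> U \<and> y \<in> V \<and> disjnt U V"
      using sep[of x y] sep[of y x] xy disjnt_sym by metis
  qed
qed

text \<open>The order alone forces this convergence, in every Priestley topology; this is the hold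
  that (c) has on an unknown topology. Assumption \<open>inf\<close> says that \<open>w\<close> is
  the only lower bound of the chain that lies above \<open>w\<close>.\<close>

lemma priestley_space_decreasing_chain_limit:
  fixes a :: "nat \<Rightarrow> 'a"
  assumes P: "priestley_space X T le" and "poset X le"
    and a: "\<And>m. a m \<in> X" and w: "w \<in> X" "\<And>m. le w (a m)"
    and dec: "\<And>m n. m \<le> n \<Longrightarrow> le (a n) (a m)"
    and inf: "\<And>z. \<lbrakk>z \<in> X; le w z; \<And>m. le z (a m)\<rbrakk> \<Longrightarrow> z = w"
    and U: "openin T U" "w \<in> U"
  shows "\<exists>m. a m \<in> U"
proof (rule ccontr)
  assume no: "\<nexists>m. a m \<in> U"
  \<comment> \<open>If \<open>U\<close> missed the chain, these closed pieces of the intervals from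
    \<open>w\<close> to \<open>a m\<close> would be nested and nonempty, as they contain
    \<open>a m\<close>. A common point would be \<open>w\<close> by \<open>inf\<close>, yet lie
    outside \<open>U\<close>.\<close>
  define K where "K m = (X - U) \<inter> (up_closure X le w \<inter> down_closure X le (a m))" for m
  have top: "topspace T = X" and cpt: "compact_space T"
    using P by (auto simp: priestley_space_def)
  have tr: "le x z" if "le x y" "le y z" "x \<in> X" "y \<in> X" "z \<in> X" for x y z
    using \<open>poset X le\<close> that unfolding poset_def by blast
  have "closedin T (X - U)"
    using U top by auto
  then have cl: "closedin T (K m)" for m
    unfolding K_def using P a w
    by (intro closedin_Int priestley_space_closedin_up_closure priestley_space_closedin_down_closure)
  have ne: "K m \<noteq> {}" for m
    using no a w dec[of m m] by (auto simp: K_def up_closure_def down_closure_def)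
  have mono: "decseq K"
    unfolding decseq_def K_def down_closure_def using dec tr a by blast
  have "(\<Inter>m. K m) \<noteq> {}"
    using compact_space_imp_nest[OF cpt cl ne mono] .
  then obtain z where z: "\<And>m. z \<in> K m"
    by blast
  then have "z = w"
    using inf[of z] by (auto simp: K_def up_closure_def down_closure_def)
  then show False
    using z[of 0] U by (auto simp: K_def)
qed

section \<open>Order components\<close>

lemma tranclp_comparable_sym:
  "(comparable X le)\<^sup>+\<^sup>+ x y \<Longrightarrow> (comparable X le)\<^sup>+\<^sup>+ y x"
proof (induction rule: tranclp_induct)
  case (base y)
  then show ?case
    by (auto simp: comparable_def intro: tranclp.r_into_trancl)
next
  case (step y z)
  then have "comparable X le z y"
    by (auto simp: comparable_def)
  then show ?case
    using step.IH by (rule tranclp_into_tranclp2)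
qed

lemma order_component_subset:
  assumes "Y \<in> order_components X le"
  shows "Y \<subseteq> X"
proof -
  have "y \<in> X" if "(comparable X le)\<^sup>+\<^sup>+ x y" for x y
    using that by (induction rule: tranclp_induct) (auto simp: comparable_def)
  then show ?thesis
    using assms by (auto simp: order_components_def)
qed

lemma order_component_closed:
  assumes "Y \<in> order_components X le" "y \<in> Y" "z \<in> X" "le y z \<or> le z y"
  shows "z \<in> Y"
proof -
  have "comparable X le y z"
    using assms order_component_subset[of Y X le] by (auto simp: comparable_def)
  then show ?thesis
    using assms by (auto simp: order_components_def intro: tranclp.trancl_into_trancl)
qed

lemma order_component_unique:
  assumes "Y \<in> order_components X le" "Y' \<in> order_components X le" "z \<in> Y" "z \<in> Y'"
  shows "Y = Y'"
proof -
  obtain x x' where "Y = {y. (comparable X le)\<^sup>+\<^sup>+ x y}" "Y' = {y. (comparable X le)\<^sup>+\<^sup>+ x' y}"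
    using assms unfolding order_components_def by blast
  moreover from this have "(comparable X le)\<^sup>+\<^sup>+ x x'" "(comparable X le)\<^sup>+\<^sup>+ x' x"
    using assms tranclp_trans tranclp_comparable_sym by (metis mem_Collect_eq)+
  ultimately show ?thesis
    by (auto intro: tranclp_trans)
qed

lemma order_component_exists:
  assumes "poset X le" "x \<in> X"
  obtains Y where "Y \<in> order_components X le" "x \<in> Y"
proof -
  have "comparable X le x x"
    using assms by (auto simp: comparable_def poset_def)
  then show ?thesis
    using that[of "{y. (comparable X le)\<^sup>+\<^sup>+ x y}"] assms
    by (auto simp: order_components_def)
qed

lemma order_component_nonempty:
  assumes "poset X le" "Y \<in> order_components X le"
  shows "Y \<noteq> {}"
proof -
  obtain x where x: "x \<in> X" "Y = {y. (comparable X le)\<^sup>+\<^sup>+ x y}"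
    using assms unfolding order_components_def by blast
  have "comparable X le x x"
    using assms x by (auto simp: comparable_def poset_def)
  then show ?thesis
    using x by auto
qed

section \<open>Representable components\<close>

lemma representable_if_components_representable:
  assumes po: "poset X le" and rep: "\<forall>Y\<in>order_components X le. representable Y le"
  shows "representable X le"
proof (cases "X = {}")
  case True
  then have "priestley_space X (discrete_topology {}) le"
    by (simp add: priestley_space_def compact_space_discrete_topology)
  then show ?thesis
    by (auto simp: representable_def)
next
  case False
  let ?C = "order_components X le"
  note sub = order_component_subset[of _ X le]
  note uniq = order_component_unique[of _ X le]
  obtain x0 where x0: "x0 \<in> X"
    using False by blast
  obtain Y0 where Y0: "Y0 \<in> ?C" "x0 \<in> Y0"
    using order_component_exists[OF po x0] .
  obtain t where t: "\<And>Y. Y \<in> ?C \<Longrightarrow> priestley_space Y (t Y) le"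
    using rep unfolding representable_def by metis
  have top: "topspace (t Y) = Y" and cpt: "compact_space (t Y)" if "Y \<in> ?C" for Y
    using t[OF that] by (auto simp: priestley_space_def)
  \<comment> \<open>The plain disjoint sum of infinitely many components is not compact; the last
    clause makes the components converge to \<open>x0\<close>.\<close>
  define opn where "opn U \<longleftrightarrow> U \<subseteq> X \<and> (\<forall>Y\<in>?C. openin (t Y) (U \<inter> Y)) \<and>
      (x0 \<in> U \<longrightarrow> finite {Y\<in>?C. \<not> Y \<subseteq> U})" for U
  have ist: "istopology opn"
    unfolding istopology_def
  proof (intro conjI allI impI)
    fix S U assume S: "opn S" and U: "opn U"
    have "openin (t Y) (S \<inter> U \<inter> Y)" if "Y \<in> ?C" for Y
    proof -
      have "openin (t Y) ((S \<inter> Y) \<inter> (U \<inter> Y))"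
        using S U that by (intro openin_Int[of _ "S \<inter> Y"]) (auto simp: opn_def)
      moreover have "(S \<inter> Y) \<inter> (U \<inter> Y) = S \<inter> U \<inter> Y"
        by blast
      ultimately show ?thesis by simp
    qed
    moreover have "finite {Y\<in>?C. \<not> Y \<subseteq> S \<inter> U}" if "x0 \<in> S \<inter> U"
    proof -
      have "{Y\<in>?C. \<not> Y \<subseteq> S \<inter> U} = {Y\<in>?C. \<not> Y \<subseteq> S} \<union> {Y\<in>?C. \<not> Y \<subseteq> U}"
        by blast
      then show ?thesis
        using S U that by (simp add: opn_def)
    qed
    ultimately show "opn (S \<inter> U)"
      using S by (auto simp: opn_def)
  next
    fix \<K> assume K: "\<forall>K\<in>\<K>. opn K"
    have "openin (t Y) (\<Union>\<K> \<inter> Y)" if "Y \<in> ?C" for Y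
    proof -
      have "openin (t Y) (\<Union>K\<in>\<K>. K \<inter> Y)"
        using K that by (intro openin_Union) (auto simp: opn_def)
      moreover have "(\<Union>K\<in>\<K>. K \<inter> Y) = \<Union>\<K> \<inter> Y"
        by blast
      ultimately show ?thesis by simp
    qed
    moreover have "finite {Y\<in>?C. \<not> Y \<subseteq> \<Union>\<K>}" if x0K: "x0 \<in> \<Union>\<K>"
    proof -
      obtain K' where K': "K' \<in> \<K>" "x0 \<in> K'"
        using x0K by blast
      then have "finite {Y\<in>?C. \<not> Y \<subseteq> K'}"
        using K by (simp add: opn_def)
      then show ?thesis
        by (rule rev_finite_subset) (use K' in blast)
    qed
    moreover have "\<Union>\<K> \<subseteq> X"
      using K by (auto simp: opn_def)
    ultimately show "opn (\<Union>\<K>)"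
      unfolding opn_def by simp
  qed
  define T where "T = topology opn"
  have T: "openin T U \<longleftrightarrow> opn U" for U
    by (simp add: T_def ist topology_inverse')
  have int: "X \<inter> Y = Y" if "Y \<in> ?C" for Y
    using sub[OF that] by blast
  have openY: "openin (t Y) Y" if "Y \<in> ?C" for Y
    using openin_topspace[of "t Y"] top[OF that] by simp
  have "{Y\<in>?C. \<not> Y \<subseteq> X} = {}"
    using sub by blast
  then have "opn X"
    unfolding opn_def by (simp add: int openY del: Collect_empty_eq)
  then have topT: "topspace T = X"
    using T openin_topspace[of T] openin_subset[of T X] by (auto simp: opn_def)

  have opnI: "opn U" if "U \<subseteq> Y" "Y \<in> ?C" "openin (t Y) U" "x0 \<notin> U" for U Y
  proof -
    have "openin (t Z) (U \<inter> Z)" if Z: "Z \<in> ?C" for Z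
    proof (cases "Z = Y")
      case True
      then show ?thesis
        using that \<open>U \<subseteq> Y\<close> \<open>openin (t Y) U\<close> by (simp add: Int_absorb2)
    next
      case False
      then have "U \<inter> Z = {}"
        using uniq[OF Z \<open>Y \<in> ?C\<close>] \<open>U \<subseteq> Y\<close> by blast
      then show ?thesis by simp
    qed
    then show ?thesis
      using that sub by (auto simp: opn_def)
  qed
  \<comment> \<open>Only \<open>Y\<close> can fail to lie inside \<open>X - U\<close>, so the
    finiteness clause holds even if \<open>x0\<close> is in \<open>X - U\<close>.\<close>
  have opnI': "opn (X - U)" if "U \<subseteq> Y" "Y \<in> ?C" "closedin (t Y) U" for U Y
  proof -
    have "openin (t Z) ((X - U) \<inter> Z)" if Z: "Z \<in> ?C" for Z
    proof (cases "Z = Y")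
      case True
      then have "(X - U) \<inter> Z = Y - U"
        using sub[OF Z] by blast
      then show ?thesis
        using \<open>closedin (t Y) U\<close> top[OF \<open>Y \<in> ?C\<close>] True by (auto simp: closedin_def)
    next
      case False
      then have "(X - U) \<inter> Z = Z"
        using uniq[OF Z \<open>Y \<in> ?C\<close>] \<open>U \<subseteq> Y\<close> sub[OF Z] by blast
      then show ?thesis
        using openY[OF Z] by simp
    qed
    moreover have "{Z\<in>?C. \<not> Z \<subseteq> X - U} \<subseteq> {Y}"
      using uniq[OF _ \<open>Y \<in> ?C\<close>] \<open>U \<subseteq> Y\<close> sub by blast
    then have "finite {Z\<in>?C. \<not> Z \<subseteq> X - U}"
      by (rule finite_subset) simp
    ultimately show ?thesis
      by (auto simp: opn_def)
  qed
  have clopenI: "openin T U \<and> closedin T U"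
    if "U \<subseteq> Y" "Y \<in> ?C" "openin (t Y) U" "closedin (t Y) U" "x0 \<notin> U" for U Y
  proof -
    have "U \<subseteq> X"
      using that sub by blast
    then show ?thesis
      using opnI[of U Y] opnI'[of U Y] that by (auto simp: closedin_def topT T)
  qed
  have clopenI': "openin T (X - U) \<and> closedin T (X - U)"
    if "U \<subseteq> Y" "Y \<in> ?C" "openin (t Y) U" "closedin (t Y) U" "x0 \<notin> U" for U Y
    using clopenI[OF that] topT by auto

  \<comment> \<open>A member of the cover that contains \<open>x0\<close> swallows all but finitely
    many components, and each remaining one is compact in its own topology.\<close>
  have "compact_space T"
    unfolding compact_space_alt topT
  proof (intro allI impI)
    fix \<U> assume \<U>: "(\<forall>U\<in>\<U>. openin T U) \<and> X \<subseteq> \<Union>\<U>"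
    obtain U0 where U0: "U0 \<in> \<U>" "x0 \<in> U0"
      using \<U> x0 by blast
    let ?F = "{Y\<in>?C. \<not> Y \<subseteq> U0}"
    have fin: "finite ?F"
      using \<U> U0 by (auto simp: T opn_def)
    have "\<exists>\<F>. finite \<F> \<and> \<F> \<subseteq> \<U> \<and> Y \<subseteq> \<Union>\<F>" if Y: "Y \<in> ?C" for Y
    proof -
      have "\<forall>V\<in>(\<lambda>U. U \<inter> Y) ` \<U>. openin (t Y) V"
        using \<U> Y by (auto simp: T opn_def)
      moreover have "topspace (t Y) \<subseteq> \<Union>((\<lambda>U. U \<inter> Y) ` \<U>)"
        using \<U> sub[OF Y] top[OF Y] by blast
      ultimately obtain \<G> where \<G>: "finite \<G>" "\<G> \<subseteq> (\<lambda>U. U \<inter> Y) ` \<U>" "topspace (t Y) \<subseteq> \<Union>\<G>"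
        using cpt[OF Y] unfolding compact_space_alt by meson
      then obtain \<F> where \<F>: "finite \<F>" "\<F> \<subseteq> \<U>" "\<G> = (\<lambda>U. U \<inter> Y) ` \<F>"
        by (meson finite_subset_image)
      then have "Y \<subseteq> \<Union>\<F>"
        using \<G>(3) top[OF Y] by blast
      then show ?thesis
        using \<F> by blast
    qed
    then obtain f where f: "\<And>Y. Y \<in> ?C \<Longrightarrow> finite (f Y) \<and> f Y \<subseteq> \<U> \<and> Y \<subseteq> \<Union>(f Y)"
      by metis
    let ?\<F> = "insert U0 (\<Union>Y\<in>?F. f Y)"
    have "finite ?\<F>" "?\<F> \<subseteq> \<U>"
      using fin f U0 by auto
    moreover have "X \<subseteq> \<Union>?\<F>"
    proof
      fix x assume "x \<in> X"
      then obtain Y where Y: "Y \<in> ?C" "x \<in> Y"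
        using order_component_exists[OF po] by blast
      show "x \<in> \<Union>?\<F>"
      proof (cases "Y \<subseteq> U0")
        case False
        moreover have "x \<in> \<Union>(f Y)"
          using f[OF Y(1)] Y(2) by blast
        ultimately show ?thesis
          using Y(1) by blast
      qed (use Y in blast)
    qed
    ultimately show "\<exists>\<F>. finite \<F> \<and> \<F> \<subseteq> \<U> \<and> X \<subseteq> \<Union>\<F>"
      by blast
  qed
  moreover have "\<exists>U. openin T U \<and> closedin T U \<and> is_downset X le U \<and> x \<in> U \<and> y \<notin> U"
    if xy: "x \<in> X" "y \<in> X" "\<not> le y x" for x y
  proof -
    obtain Y where Y: "Y \<in> ?C" "x \<in> Y"
      using order_component_exists[OF po xy(1)] .
    obtain Z where Z: "Z \<in> ?C" "y \<in> Z"
      using order_component_exists[OF po xy(2)] .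
    have clY: "closedin (t W) W" if "W \<in> ?C" for W
      using closedin_topspace[of "t W"] top[OF that] by simp
    \<comment> \<open>Comparabilities never leave a component, so a down-set of a component is one
      of \<open>X\<close>, alone or together with all other components.\<close>
    have dn: "is_downset X le U" if "is_downset W le U" "W \<in> ?C" for U W
      using that sub[OF that(2)] order_component_closed[OF that(2)]
      unfolding is_downset_def by blast
    have dn': "is_downset X le (X - (W - U))" if "is_downset W le U" "W \<in> ?C" for U W
      using that sub[OF that(2)] order_component_closed[OF that(2)]
      unfolding is_downset_def by blast
    have dW: "is_downset W le W" "is_downset W le {}" for W
      by (auto simp: is_downset_def)
    have sep: "\<exists>U. openin (t Y) U \<and> closedin (t Y) U \<and> is_downset Y le U \<and> x \<in> U \<and> y \<notin> U"
      if "y \<in> Y"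
      using t[OF Y(1)] Y(2) that xy(3) by (simp add: priestley_space_def)
    show ?thesis
    proof (cases "Y = Z")
      case True
      then have "y \<in> Y"
        using Z(2) by simp
      from sep[OF this] obtain U where U: "openin (t Y) U" "closedin (t Y) U" "is_downset Y le U"
          "x \<in> U" "y \<notin> U"
        by (elim exE conjE)
      show ?thesis
      proof (cases "x0 \<in> U")
        case False
        have "U \<subseteq> Y"
          using U(3) by (simp add: is_downset_def)
        then have "openin T U \<and> closedin T U"
          using clopenI[OF _ Y(1) U(1,2) False] by simp
        then show ?thesis
          using dn[OF U(3) Y(1)] U(4,5) by (intro exI[of _ U]) simp
      next
        \<comment> \<open>Here \<open>clopenI\<close> does not apply to \<open>U\<close>. Adding all
          other components to \<open>U\<close> gives a set whose complement \<open>Y - U\<close>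
          avoids \<open>x0\<close> and still contains y.\<close>
        case True
        have "openin (t Y) (Y - U)" "closedin (t Y) (Y - U)"
          using openin_diff[OF openY[OF Y(1)] U(2)] closedin_diff[OF clY[OF Y(1)] U(1)] .
        then have "openin T (X - (Y - U)) \<and> closedin T (X - (Y - U))"
          using clopenI'[of "Y - U" Y] True Y(1) by simp
        then show ?thesis
          using dn'[OF U(3) Y(1)] U(4,5) Z(2) \<open>Y = Z\<close> xy(1)
          by (intro exI[of _ "X - (Y - U)"]) simp
      qed
    next
      case False
      then have "y \<notin> Y" "x \<notin> Z"
        using uniq[of Y Z] Y Z by auto
      \<comment> \<open>Points of different components: \<open>Y\<close> itself separates them if it
        avoids \<open>x0\<close>; otherwise \<open>Z\<close> avoids \<open>x0\<close> and its
        complement separates them.\<close>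
      show ?thesis
      proof (cases "x0 \<in> Y")
        case False
        then show ?thesis
          using clopenI[OF order.refl Y(1) openY[OF Y(1)] clY[OF Y(1)]] Y(2) dn[OF dW(1) Y(1)]
            \<open>y \<notin> Y\<close>
          by (intro exI[of _ Y]) simp
      next
        case True
        then have "x0 \<notin> Z"
          using uniq[of Y Z] Y Z \<open>Y \<noteq> Z\<close> by blast
        then have "openin T (X - Z) \<and> closedin T (X - Z)"
          using clopenI'[OF order.refl Z(1) openY[OF Z(1)] clY[OF Z(1)]] by simp
        then show ?thesis
          using dn'[OF dW(2) Z(1)] Z(2) \<open>x \<notin> Z\<close> xy(1) by (intro exI[of _ "X - Z"]) simp
      qed
    qed
  qed
  ultimately have "priestley_space X T le"
    by (simp add: priestley_space_def topT)
  then show ?thesis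
    by (auto simp: representable_def)
qed

section \<open>Compactness of components\<close>

text \<open>\<open>Alexander_subbase\<close> yields compactness of \<open>S\<close>. Every member of
  \<open>B\<close> is open in \<open>S\<close>, so the generated topology is coarser than
  \<open>S\<close> on the same points and inherits compactness.\<close>

lemma compact_space_topology_generated_by:
  assumes "\<And>C. \<lbrakk>C \<subseteq> B; \<Union>C = \<Union>B\<rbrakk> \<Longrightarrow> \<exists>C'. finite C' \<and> C' \<subseteq> C \<and> \<Union>C' = \<Union>B"
  shows "compact_space (topology_generated_by B)"
proof -
  define S where
    "S = topology (arbitrary union_of (finite intersection_of (\<lambda>x. x \<in> B) relative_to \<Union>B))"
  have top: "topspace S = \<Union>B"
    by (simp add: S_def)
  have cpt: "compact_space S"
    by (rule Alexander_subbase[of B]) (use assms top S_def in auto)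
  have "openin S s" if "s \<in> B" for s
  proof -
    have "(finite intersection_of (\<lambda>x. x \<in> B)) s"
      using that by (simp add: finite_intersection_of_inc)
    then have "(finite intersection_of (\<lambda>x. x \<in> B) relative_to \<Union>B) (\<Union>B \<inter> s)"
      by (rule relative_to_inc)
    moreover have "\<Union>B \<inter> s = s"
      using that by blast
    ultimately show ?thesis
      unfolding S_def openin_subbase by (simp add: arbitrary_union_of_inc)
  qed
  then have "openin S U" if "openin (topology_generated_by B) U" for U
    using generate_topology_on_coarsest[of "openin S" B U] that
    by (auto simp: openin_topology_generated_by_iff)
  then show ?thesis
    using cpt top unfolding compact_space_alt topology_generated_by_topspace by metis
qed

text \<open>\<open>Y\<close> need not be compact in \<open>T\<close>, but after one subbasic set
  other than \<open>Y\<close> is chosen from a cover, only a principal set of \<open>Y\<close> is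
  left to cover. It equals the principal set formed in \<open>X\<close>, hence is compact in
  \<open>T\<close>.\<close>

lemma component_interval_topology_compact:
  assumes po: "poset X le" and rep: "representable X le" and Y: "Y \<in> order_components X le"
  shows "compact_space (interval_topology Y le)"
proof -
  obtain T where P: "priestley_space X T le"
    using rep by (auto simp: representable_def)
  have top: "topspace T = X" and cpt: "compact_space T"
    using P by (auto simp: priestley_space_def)
  have YX: "Y \<subseteq> X" and ne: "Y \<noteq> {}"
    using order_component_subset[OF Y] order_component_nonempty[OF po Y] by auto
  let ?S = "{Y - down_closure Y le x | x. x \<in> Y} \<union> {Y - up_closure Y le x | x. x \<in> Y}"
  have cl: "closedin T (Y - c)" if "c \<in> ?S" for c
  proof -
    have "down_closure Y le x = down_closure X le x" "up_closure Y le x = up_closure X le x"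
      if "x \<in> Y" for x
      using order_component_closed[OF Y that] YX by (auto simp: down_closure_def up_closure_def)
    moreover have "Y - (Y - down_closure Y le x) = down_closure Y le x"
      "Y - (Y - up_closure Y le x) = up_closure Y le x" for x
      by (auto simp: down_closure_def up_closure_def)
    ultimately show ?thesis
      using that YX priestley_space_closedin_down_closure[OF P]
        priestley_space_closedin_up_closure[OF P] by (smt (verit) Un_iff mem_Collect_eq subsetD)
  qed
  show ?thesis
    unfolding interval_topology_def
  proof (rule compact_space_topology_generated_by)
    fix C assume C: "C \<subseteq> insert Y ?S" "\<Union>C = \<Union>(insert Y ?S)"
    have UY: "\<Union>(insert Y ?S) = Y"
      by auto
    then have UC: "\<Union>C = Y"
      using C(2) by simp
    show "\<exists>C'. finite C' \<and> C' \<subseteq> C \<and> \<Union>C' = \<Union>(insert Y ?S)"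
    proof (cases "Y \<in> C")
      case True
      then show ?thesis
        unfolding UY by (intro exI[of _ "{Y}"]) simp
    next
      case False
      then have CS: "C \<subseteq> ?S"
        using C by blast
      have clC: "closedin T (Y - c)" if "c \<in> C" for c
        using cl[OF subsetD[OF CS that]] .
      have "C \<noteq> {}"
        using UC ne by auto
      then obtain c0 where c0: "c0 \<in> C"
        by auto
      have "compactin T (Y - c0)"
        using clC[OF c0] by (rule closedin_compact_space[OF cpt])
      \<comment> \<open>Replacing c by this set gives an open set of \<open>T\<close> with trace c
        on \<open>Y\<close>; c itself need not be open in \<open>T\<close>.\<close>
      moreover have "openin T (X - (Y - c))" if "c \<in> C" for c
        using clC[OF that] top by (metis openin_diff openin_topspace)
      then have "\<forall>U\<in>(\<lambda>c. X - (Y - c)) ` C. openin T U"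
        by simp
      moreover have "y \<in> \<Union>((\<lambda>c. X - (Y - c)) ` C)" if y: "y \<in> Y" for y
      proof -
        obtain c where "c \<in> C" "y \<in> c"
          using y UC by blast
        then show ?thesis
          using y YX by auto
      qed
      then have "Y - c0 \<subseteq> \<Union>((\<lambda>c. X - (Y - c)) ` C)"
        by (meson DiffD1 subsetI)
      ultimately obtain \<F> where \<F>: "finite \<F>" "\<F> \<subseteq> (\<lambda>c. X - (Y - c)) ` C" "Y - c0 \<subseteq> \<Union>\<F>"
        unfolding compactin_def by meson
      then obtain C' where C': "finite C'" "C' \<subseteq> C" "\<F> = (\<lambda>c. X - (Y - c)) ` C'"
        by (meson finite_subset_image)
      have "Y \<subseteq> \<Union>(insert c0 C')"
        using \<F>(3) C' by blast
      moreover have "\<Union>(insert c0 C') \<subseteq> Y"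
        using UC C'(2) c0 by blast
      ultimately show ?thesis
        unfolding UY using C' c0 by (intro exI[of _ "insert c0 C'"]) blast
    qed
  qed
qed

section \<open>A component that is not representable\<close>

definition cantor_topology :: "nat set topology" where
  "cantor_topology = topology_generated_by (range (\<lambda>n. {A. n \<in> A}) \<union> range (\<lambda>n. {A. n \<notin> A}))"

lemma topspace_cantor_topology [simp]: "topspace cantor_topology = UNIV"
  by (auto simp: cantor_topology_def)

lemma compact_space_cantor_topology: "compact_space cantor_topology"
  unfolding cantor_topology_def
proof (rule compact_space_topology_generated_by)
  let ?B = "range (\<lambda>n. {A. n \<in> A}) \<union> range (\<lambda>n. {A. n \<notin> A}) :: nat set set set"
  fix C assume C: "C \<subseteq> ?B" "\<Union>C = \<Union>?B"
  have U: "\<Union>?B = UNIV"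
    by auto
  \<comment> \<open>A diagonal point: it lies in no member of \<open>C\<close> of the form "n is not
    in A". So it lies in one of the form "n is in A", and by its definition the opposite set is also
    in \<open>C\<close>.\<close>
  then have "{n. {A. n \<notin> A} \<in> C} \<in> \<Union>C"
    using C(2) by simp
  then obtain c where c: "c \<in> C" "{n. {A. n \<notin> A} \<in> C} \<in> c"
    by (elim UnionE)
  then obtain n where n: "{A. n \<notin> A} \<in> C" "{A. n \<in> A} \<in> C"
    using C(1) by auto
  then show "\<exists>C'. finite C' \<and> C' \<subseteq> C \<and> \<Union>C' = \<Union>?B"
    unfolding U by (intro exI[of _ "{{A. n \<notin> A}, {A. n \<in> A}}"]) auto
qed

text \<open>Membership depends on finitely many coordinates, so \<open>S\<close> and its complement
  are both unions of cylinders.\<close>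

lemma cantor_topology_clopen:
  assumes S: "\<And>A. A \<in> S \<longleftrightarrow> A \<inter> {..<N::nat} \<in> S"
  shows "openin cantor_topology S \<and> closedin cantor_topology S"
proof -
  have cyl: "openin cantor_topology {B. B \<inter> {..<n} = A \<inter> {..<n}}" for A and n :: nat
  proof (induction n)
    case 0
    then show ?case
      using openin_topspace[of cantor_topology] by simp
  next
    case (Suc n)
    let ?E = "if n \<in> A then {B. n \<in> B} else {B. n \<notin> B}"
    have "openin cantor_topology ?E"
      unfolding cantor_topology_def by (rule topology_generated_by_Basis) auto
    moreover have "{B. B \<inter> {..<Suc n} = A \<inter> {..<Suc n}} = {B. B \<inter> {..<n} = A \<inter> {..<n}} \<inter> ?E"
      by (auto simp: lessThan_Suc)
    ultimately show ?case
      using Suc by (simp only: openin_Int)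
  qed
  have opn: "openin cantor_topology R" if R: "\<And>A. A \<in> R \<longleftrightarrow> A \<inter> {..<N} \<in> R" for R
  proof (subst openin_subopen, intro ballI)
    fix A assume "A \<in> R"
    then have "{B. B \<inter> {..<N} = A \<inter> {..<N}} \<subseteq> R"
      using R by (metis (mono_tags, lifting) mem_Collect_eq subsetI)
    then show "\<exists>T. openin cantor_topology T \<and> A \<in> T \<and> T \<subseteq> R"
      using cyl[of N A] by blast
  qed
  have "openin cantor_topology (UNIV - S)"
    by (rule opn) (use S in auto)
  then show ?thesis
    using opn[OF S] by (simp add: closedin_def)
qed

section \<open>The zigzag order\<close>

text \<open>\<open>branches C N A\<close>: the word \<open>A\<close> properly extends the word \<open>C\<close>, and the next letter is
  less than \<open>N\<close>.\<close>

definition branches :: "nat set \<Rightarrow> nat \<Rightarrow> nat set \<Rightarrow> bool" where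
  "branches C N A \<longleftrightarrow> (\<exists>b<N. b \<in> A \<and> A \<inter> {..<b} = C)"

text \<open>Defining the order by clopen sets makes the Priestley separation property automatic.
  The lemmas \<open>zigzag_le_insert_even\<close> and \<open>zigzag_le_insert_odd\<close> below give the intended chains.\<close>

definition zigzag_le :: "nat set \<Rightarrow> nat set \<Rightarrow> bool" where
  "zigzag_le A B \<longleftrightarrow> (\<forall>C N.
     (even (card C) \<longrightarrow> branches C N A \<longrightarrow> branches C N B) \<and>
     (odd (card C) \<longrightarrow> branches C N B \<longrightarrow> branches C N A))"

text \<open>This decodes a word from its branches: no element b of \<open>A\<close> below d has the
  prefix \<open>A\<close> up to d, because that prefix contains b, and the bound
  \<open>Suc d\<close> leaves only b = d.\<close>

lemma branches_initial_iff: "branches (A \<inter> {..<d}) (Suc d) A \<longleftrightarrow> d \<in> A"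
proof
  assume "branches (A \<inter> {..<d}) (Suc d) A"
  then obtain b where b: "b < Suc d" "b \<in> A" "A \<inter> {..<b} = A \<inter> {..<d}"
    by (auto simp: branches_def)
  then have "\<not> b < d"
    by blast
  then show "d \<in> A"
    using b by (simp add: less_Suc_eq)
qed (auto simp: branches_def)

text \<open>Appending a last letter m creates exactly one new branching point, with prefix
  \<open>A\<close>. Its parity decides how the extension compares with \<open>A\<close>.\<close>

lemma branches_insert:
  assumes "A \<subseteq> {..<m}"
  shows "branches C N (insert m A) \<longleftrightarrow> branches C N A \<or> C = A \<and> m < N"
proof -
  have "insert m A \<inter> {..<b} = A \<inter> {..<b}" if "b \<in> A" for b
    using assms that by auto
  moreover have "insert m A \<inter> {..<m} = A"
    using assms by auto
  ultimately show ?thesis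
    unfolding branches_def by (metis insert_iff)
qed

lemma zigzag_le_refl: "zigzag_le A A"
  by (simp add: zigzag_le_def)

lemma zigzag_le_trans: "zigzag_le A B \<Longrightarrow> zigzag_le B C \<Longrightarrow> zigzag_le A C"
  by (simp add: zigzag_le_def)

lemma zigzag_le_antisym:
  assumes "zigzag_le A B" "zigzag_le B A"
  shows "A = B"
proof -
  have br: "branches C N A \<longleftrightarrow> branches C N B" for C N
    using assms unfolding zigzag_le_def by blast
  have "d \<in> A \<longleftrightarrow> d \<in> B" for d
  proof (induction d rule: less_induct)
    case (less d)
    then have "A \<inter> {..<d} = B \<inter> {..<d}"
      by auto
    then show ?case
      using br branches_initial_iff by metis
  qed
  then show ?thesis by blast
qed

lemma poset_zigzag_le: "poset X zigzag_le"
  unfolding poset_def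
  using zigzag_le_refl zigzag_le_trans zigzag_le_antisym by blast

text \<open>The sets of all words satisfying \<open>branches C N\<close> depend only on coordinates
  below N, hence are clopen. They are up-sets for even and down-sets for odd \<open>card C\<close>,
  and failure of the order is witnessed by one of them.\<close>

lemma priestley_space_zigzag: "priestley_space UNIV cantor_topology zigzag_le"
proof -
  have clopen: "openin cantor_topology {A. branches C N A} \<and> closedin cantor_topology {A. branches C N A}"
    for C N
  proof (rule cantor_topology_clopen[of _ N])
    fix A
    have "A \<inter> {..<N} \<inter> {..<b} = A \<inter> {..<b}" if "b < N" for b
      using that by auto
    then show "A \<in> {A. branches C N A} \<longleftrightarrow> A \<inter> {..<N} \<in> {A. branches C N A}"
      by (auto simp: branches_def)
  qed
  have "\<exists>U. openin cantor_topology U \<and> closedin cantor_topology U \<and>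
      is_downset UNIV zigzag_le U \<and> A \<in> U \<and> B \<notin> U" if nle: "\<not> zigzag_le B A" for A B
  proof -
    obtain C N where "even (card C) \<and> branches C N B \<and> \<not> branches C N A \<or>
        odd (card C) \<and> branches C N A \<and> \<not> branches C N B"
      using nle unfolding zigzag_le_def by blast
    then consider "even (card C)" "branches C N B" "\<not> branches C N A"
      | "odd (card C)" "branches C N A" "\<not> branches C N B"
      by blast
    then show ?thesis
    proof cases
      case 1
      then have "is_downset UNIV zigzag_le (UNIV - {A. branches C N A})"
        by (auto simp: is_downset_def zigzag_le_def)
      moreover have "openin cantor_topology (UNIV - {A. branches C N A})"
          "closedin cantor_topology (UNIV - {A. branches C N A})"
        using clopen[of C N] by (metis topspace_cantor_topology openin_diff openin_topspace,
          metis topspace_cantor_topology closedin_diff closedin_topspace)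
      ultimately show ?thesis
        using 1 by blast
    next
      case 2
      then have "is_downset UNIV zigzag_le {A. branches C N A}"
        by (auto simp: is_downset_def zigzag_le_def)
      then show ?thesis
        using 2 clopen[of C N] by blast
    qed
  qed
  then show ?thesis
    by (simp add: priestley_space_def compact_space_cantor_topology)
qed

text \<open>A larger last letter passes the bound \<open>m < N\<close> for fewer N, so the
  extensions of an even word descend as the letter grows.\<close>

lemma zigzag_le_insert_even:
  assumes "A \<subseteq> {..<m}" "even (card A)"
  shows "zigzag_le A (insert m A)"
    and "m \<le> n \<Longrightarrow> zigzag_le (insert n A) (insert m A)"
proof -
  show "zigzag_le A (insert m A)"
    using assms by (auto simp: zigzag_le_def branches_insert)
  assume "m \<le> n"
  then have "A \<subseteq> {..<n}"
    using assms by auto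
  then show "zigzag_le (insert n A) (insert m A)"
    using assms \<open>m \<le> n\<close> by (auto simp: zigzag_le_def branches_insert)
qed

lemma zigzag_le_insert_odd:
  assumes "A \<subseteq> {..<m}" "odd (card A)"
  shows "zigzag_le (insert m A) A"
    and "m \<le> n \<Longrightarrow> zigzag_le (insert m A) (insert n A)"
proof -
  show "zigzag_le (insert m A) A"
    using assms by (auto simp: zigzag_le_def branches_insert)
  assume "m \<le> n"
  then have "A \<subseteq> {..<n}"
    using assms by auto
  then show "zigzag_le (insert m A) (insert n A)"
    using assms \<open>m \<le> n\<close> by (auto simp: zigzag_le_def branches_insert)
qed

section \<open>The finite words as an order component\<close>

lemma infinite_initial_parity:
  fixes A :: "nat set"
  assumes "infinite A"
  shows "\<exists>e\<in>A. f < e \<and> (even (card (A \<inter> {..<e})) \<longleftrightarrow> p)"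
proof -
  have next_elem: "\<exists>e\<in>A. f < e \<and> A \<inter> {f<..<e} = {}" for f
  proof -
    have ex: "\<exists>e. e \<in> A \<and> f < e"
      using assms by (auto simp: infinite_nat_iff_unbounded)
    let ?e = "LEAST e. e \<in> A \<and> f < e"
    have "?e \<in> A \<and> f < ?e"
      using LeastI_ex[OF ex] .
    moreover have "A \<inter> {f<..<?e} = {}"
      using not_less_Least by fastforce
    ultimately show ?thesis by blast
  qed
  obtain e where e: "e \<in> A" "f < e"
    using next_elem by blast
  obtain e' where e': "e' \<in> A" "e < e'" "A \<inter> {e<..<e'} = {}"
    using next_elem by blast
  have "A \<inter> {..<e'} = insert e (A \<inter> {..<e})"
    using e e' by (auto simp: disjoint_iff)
  then have "card (A \<inter> {..<e'}) = Suc (card (A \<inter> {..<e}))"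
    by simp
  then show ?thesis
    using e e' by (metis even_Suc less_trans)
qed

text \<open>Prefixes of either parity occur arbitrarily far out in \<open>A\<close>, so
  \<open>B\<close> shares arbitrarily long prefixes with \<open>A\<close>. As one parity suffices, a
  comparability in a single direction already forces equality.\<close>

lemma infinite_determined_by_branches:
  assumes inf: "infinite A"
    and br: "\<And>C N. \<lbrakk>even (card C) \<longleftrightarrow> p; branches C N A\<rbrakk> \<Longrightarrow> branches C N B"
  shows "B = A"
proof -
  have "d \<in> B \<longleftrightarrow> d \<in> A" for d
  proof -
    obtain f where f: "f \<in> A" "d < f"
      using inf by (auto simp: infinite_nat_iff_unbounded)
    obtain e where e: "e \<in> A" "f < e" "even (card (A \<inter> {..<e})) \<longleftrightarrow> p"
      using infinite_initial_parity[OF inf] by blast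
    then have "branches (A \<inter> {..<e}) (Suc e) B"
      using br by (simp add: branches_initial_iff)
    then obtain b where b: "B \<inter> {..<b} = A \<inter> {..<e}"
      by (auto simp: branches_def)
    then have "f < b"
      using e f by blast
    then show ?thesis
      using b e f by (metis IntE IntI lessThan_iff less_trans)
  qed
  then show ?thesis by blast
qed

lemma zigzag_comparable_finite:
  assumes "zigzag_le A B \<or> zigzag_le B A"
  shows "finite A \<longleftrightarrow> finite B"
proof -
  have "B = A" if "infinite A" "zigzag_le A B \<or> zigzag_le B A" for A B
    using infinite_determined_by_branches[OF that(1), of True B]
      infinite_determined_by_branches[OF that(1), of False B] that(2)
    unfolding zigzag_le_def by blast
  then show ?thesis
    using assms by blast
qed

lemma initial_segment_of_card:
  fixes A :: "nat set"
  assumes "finite A" "k < card A"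
  shows "\<exists>b\<in>A. card (A \<inter> {..<b}) = k"
  using assms
proof (induction A rule: finite_linorder_max_induct)
  case (insert b A)
  have *: "insert b A \<inter> {..<b} = A" and **: "\<And>a. a \<in> A \<Longrightarrow> insert b A \<inter> {..<a} = A \<inter> {..<a}"
    using insert.hyps by force+
  have "b \<notin> A"
    using insert.hyps by blast
  then consider "k < card A" | "k = card A"
    using insert.prems insert.hyps by fastforce
  then show ?case
    using * ** insert.IH by cases (metis insertI2, metis insertI1)
qed simp

text \<open>The element of \<open>B\<close> with exactly k predecessors is a branch over a prefix of
  length k. Transferred to \<open>A\<close>, it gives a proper initial segment of \<open>A\<close>
  with k elements.\<close>

lemma card_less_by_branches:
  assumes "finite A" "finite B" "k < card B"
    and br: "\<And>C N. \<lbrakk>card C = k; branches C N B\<rbrakk> \<Longrightarrow> branches C N A"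
  shows "k < card A"
proof -
  obtain b where b: "b \<in> B" "card (B \<inter> {..<b}) = k"
    using initial_segment_of_card assms by blast
  then have "branches (B \<inter> {..<b}) (Suc b) A"
    using br by (simp add: branches_initial_iff)
  then obtain a where a: "a \<in> A" "A \<inter> {..<a} = B \<inter> {..<b}"
    by (auto simp: branches_def)
  then have "A \<inter> {..<a} \<subset> A"
    by blast
  then have "card (A \<inter> {..<a}) < card A"
    by (rule psubset_card_mono[OF assms(1)])
  then show ?thesis
    using a b by simp
qed

text \<open>Deleting last letters one by one links a finite word to the empty word, while no
  comparability joins a finite word to an infinite one.\<close>

lemma finite_sets_component: "{A. finite A} \<in> order_components UNIV zigzag_le"
proof -
  let ?R = "(comparable UNIV zigzag_le)\<^sup>+\<^sup>+"
  have "finite B" if "?R {} B" for B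
    using that
    by (induction rule: tranclp_induct)
      (use zigzag_comparable_finite in \<open>auto simp: comparable_def\<close>)
  moreover have "?R {} B" if "finite B" for B
    using that
  proof (induction B rule: finite_linorder_max_induct)
    case empty
    then show ?case
      by (auto simp: comparable_def zigzag_le_refl)
  next
    case (insert b A)
    then have "A \<subseteq> {..<b}"
      by auto
    then have "comparable UNIV zigzag_le A (insert b A)"
      using zigzag_le_insert_even(1) zigzag_le_insert_odd(1) unfolding comparable_def by blast
    then show ?case
      using insert.IH by (rule tranclp.trancl_into_trancl[rotated])
  qed
  ultimately have "{A. finite A} = {B. ?R {} B}"
    by blast
  then show ?thesis
    by (auto simp: order_components_def)
qed

section \<open>Baire category excludes a Priestley topology on the finite words\<close>

lemma finite_sets_not_representable: "\<not> representable {A. finite A} zigzag_le"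
proof
  let ?Y = "{A :: nat set. finite A}"
  let ?L = "\<lambda>n. {A :: nat set. finite A \<and> card A \<le> n}"
  assume "representable ?Y zigzag_le"
  then obtain T where P: "priestley_space ?Y T zigzag_le"
    by (auto simp: representable_def)
  have top: "topspace T = ?Y" and cpt: "compact_space T"
    using P by (auto simp: priestley_space_def)
  have po: "poset ?Y zigzag_le" and po': "poset ?Y (\<lambda>A B. zigzag_le B A)"
    using poset_zigzag_le poset_dual[OF poset_zigzag_le] by auto
  have Hausd: "Hausdorff_space T"
    using priestley_space_imp_Hausdorff[OF P po] .

  have remove_Max: "\<exists>B m. A = insert m B \<and> B \<subseteq> {..<m} \<and> finite B \<and> card A = Suc (card B)"
    if "finite A" "A \<noteq> {}" for A :: "nat set"
  proof -
    have Max: "Max A \<in> A"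
      using that by (rule Max_in)
    have "A - {Max A} \<subseteq> {..<Max A}"
      using that by (auto simp: less_le)
    then show ?thesis
      using that(1) insert_Diff[OF Max] card.remove[OF that(1) Max]
      by (intro exI[of _ "A - {Max A}"] exI[of _ "Max A"] conjI) simp_all
  qed
  have closed: "closedin T (?L n)" for n
  proof (induction n)
    case 0
    have "?L 0 = {{}}"
      by auto
    moreover have "closedin T {{}}"
      using Hausd top by (simp add: closedin_Hausdorff_singleton)
    ultimately show ?case by simp
  next
    case (Suc n)
    then have comp: "compactin T (?L n)"
      by (rule closedin_compact_space[OF cpt])
    have step: "\<exists>B m. A = insert m B \<and> B \<subseteq> {..<m} \<and> B \<in> ?L n \<and> card B = n"
      if "A \<in> ?L (Suc n)" "A \<notin> ?L n" for A
    proof -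
      have "finite A" "card A = Suc n" "A \<noteq> {}"
        using that by auto
      then show ?thesis
        using remove_Max[of A] by auto
    qed
    show ?case
    proof (cases "even n")
      case True
      have "?L (Suc n) = {B \<in> ?Y. \<exists>A\<in>?L n. zigzag_le A B}"
      proof (intro equalityI subsetI)
        fix B assume B: "B \<in> ?L (Suc n)"
        then show "B \<in> {B \<in> ?Y. \<exists>A\<in>?L n. zigzag_le A B}"
          using step[of B] zigzag_le_insert_even(1) zigzag_le_refl[of B] True by blast
      next
        fix B assume "B \<in> {B \<in> ?Y. \<exists>A\<in>?L n. zigzag_le A B}"
        then obtain A where A: "finite B" "finite A" "card A \<le> n" "zigzag_le A B"
          by blast
        \<comment> \<open>Since \<open>Suc n\<close> is odd here, branches over prefixes of that
          length pass from \<open>B\<close> down to \<open>A\<close>, so a word longer than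
          \<open>Suc n\<close> cannot lie above one of length at most n.\<close>
        have "Suc n < card A" if "Suc n < card B"
          using A that True by (intro card_less_by_branches[of A B]) (auto simp: zigzag_le_def)
        then show "B \<in> ?L (Suc n)"
          using A by force
      qed
      then show ?thesis
        using priestley_space_closedin_up[OF P comp] by simp
    next
      case False
      have "?L (Suc n) = {B \<in> ?Y. \<exists>A\<in>?L n. zigzag_le B A}"
      proof (intro equalityI subsetI)
        fix B assume B: "B \<in> ?L (Suc n)"
        then show "B \<in> {B \<in> ?Y. \<exists>A\<in>?L n. zigzag_le B A}"
          using step[of B] zigzag_le_insert_odd(1) zigzag_le_refl[of B] False by blast
      next
        fix B assume "B \<in> {B \<in> ?Y. \<exists>A\<in>?L n. zigzag_le B A}"
        then obtain A where A: "finite B" "finite A" "card A \<le> n" "zigzag_le B A"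
          by blast
        have "Suc n < card A" if "Suc n < card B"
          using A that False by (intro card_less_by_branches[of A B]) (auto simp: zigzag_le_def)
        then show "B \<in> ?L (Suc n)"
          using A by force
      qed
      then show ?thesis
        using priestley_space_closedin_down[OF P comp] by simp
    qed
  qed

  have limit: "\<exists>B\<in>U. finite B \<and> card B = Suc (card A)"
    if U: "openin T U" "A \<in> U" and A: "finite A" for U A
  proof -
    \<comment> \<open>The shift s makes every appended letter \<open>m + s\<close> exceed all
      letters of \<open>A\<close>.\<close>
    obtain s where s: "A \<subseteq> {..<s}"
      using A finite_nat_iff_bounded by blast
    have s': "A \<subseteq> {..<m + s}" for m
      using s by auto
    have "\<exists>m. insert (m + s) A \<in> U"
    proof (cases "even (card A)")
      case True
      have "Z = A" if "zigzag_le A Z" "\<And>m. zigzag_le Z (insert (m + s) A)" for Z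
      proof (rule zigzag_le_antisym)
        \<comment> \<open>Choosing m = N hides the appended letter: \<open>N + s\<close> is not
          below N, so the extension has the same branches with bound N as \<open>A\<close>.\<close>
        have "branches C N A" if "even (card C)" "branches C N Z" for C N
          using \<open>zigzag_le Z (insert (N + s) A)\<close> that branches_insert[OF s', of C N N]
          by (auto simp: zigzag_le_def)
        moreover have "branches C N Z" if "odd (card C)" "branches C N A" for C N
          using \<open>zigzag_le Z (insert (N + s) A)\<close> that branches_insert[OF s', of C N N]
          by (auto simp: zigzag_le_def)
        ultimately show "zigzag_le Z A"
          by (auto simp: zigzag_le_def)
      qed fact
      then show ?thesis
        using A zigzag_le_insert_even[OF s' True]
        by (intro priestley_space_decreasing_chain_limit[OF P po _ _ _ _ _ U]) auto
    next
      case False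
      have "Z = A" if "zigzag_le Z A" "\<And>m. zigzag_le (insert (m + s) A) Z" for Z
      proof (rule zigzag_le_antisym)
        have "branches C N A" if "odd (card C)" "branches C N Z" for C N
          using \<open>zigzag_le (insert (N + s) A) Z\<close> that branches_insert[OF s', of C N N]
          by (auto simp: zigzag_le_def)
        moreover have "branches C N Z" if "even (card C)" "branches C N A" for C N
          using \<open>zigzag_le (insert (N + s) A) Z\<close> that branches_insert[OF s', of C N N]
          by (auto simp: zigzag_le_def)
        ultimately show "zigzag_le A Z"
          by (auto simp: zigzag_le_def)
      qed fact
      then show ?thesis
        using A zigzag_le_insert_odd[OF s' False]
        by (intro priestley_space_decreasing_chain_limit[OF priestley_space_dual[OF P] po' _ _ _ _ _ U])
          auto
    qed
    then obtain m where m: "insert (m + s) A \<in> U"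
      by blast
    moreover have "m + s \<notin> A"
      using s'[of m] by blast
    ultimately show ?thesis
      using A by (intro bexI[of _ "insert (m + s) A"]) auto
  qed
  have dense: "T interior_of (?L n) = {}" for n
    unfolding interior_of_eq_empty
  proof (intro allI impI)
    fix U assume U: "openin T U \<and> U \<subseteq> ?L n"
    \<comment> \<open>By repeated use of \<open>limit\<close>, a nonempty open set contains words of
      unbounded length, so no level has interior points.\<close>
    have "\<exists>B\<in>U. finite B \<and> card B \<ge> k" if "U \<noteq> {}" for k
    proof (induction k)
      case 0
      then show ?case
        using that U by blast
    next
      case (Suc k)
      then show ?case
        using limit U by (metis Suc_le_mono)
    qed
    from this[of "Suc n"] show "U = {}"
      using U by force
  qed
  \<comment> \<open>The levels are countably many and exhaust the space, so the whole space would
    have empty interior although it contains the empty word.\<close>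
  have "T interior_of (\<Union>(range ?L)) = {}"
  proof (rule Baire_category_alt)
    show "completely_metrizable_space T \<or> locally_compact_space T \<and> regular_space T"
      using cpt Hausd compact_imp_locally_compact_space compact_Hausdorff_imp_regular_space
      by blast
  qed (use closed dense in auto)
  moreover have "\<Union>(range ?L) = topspace T"
    using top by auto
  ultimately have "?Y = {}"
    using top by (metis interior_of_topspace)
  then show False
    by blast
qed

theorem theorem1p1:
  fixes X :: "'a set" and le :: "'a \<Rightarrow> 'a \<Rightarrow> bool"
  assumes "poset X le"
  shows "((\<forall>Y\<in>order_components X le. representable Y le) \<longrightarrow> representable X le)
    \<and> (representable X le \<longrightarrow>
         (\<forall>Y\<in>order_components X le. compact_space (interval_topology Y le)))
    \<and> (\<exists>(Z :: nat set set) r. poset Z r \<and> representable Z r \<and>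
         (\<exists>Y\<in>order_components Z r. \<not> representable Y r))"
proof (intro conjI impI ballI)
  show "representable X le" if "\<forall>Y\<in>order_components X le. representable Y le"
    using representable_if_components_representable[OF assms that] .
  show "compact_space (interval_topology Y le)"
    if "representable X le" "Y \<in> order_components X le" for Y
    using component_interval_topology_compact[OF assms that] .
  have "representable UNIV zigzag_le"
    using priestley_space_zigzag by (auto simp: representable_def)
  then show "\<exists>(Z :: nat set set) r. poset Z r \<and> representable Z r \<and>
      (\<exists>Y\<in>order_components Z r. \<not> representable Y r)"
    using poset_zigzag_le finite_sets_component finite_sets_not_representable
    by (intro exI[of _ UNIV] exI[of _ zigzag_le]) blast
qed

end
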